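(* Suppose $T : X \to X$ is a minimal homeomorphism of a compact metric space $X$ and $f : X \to \mathbb{R}$ is continuous. Let $\nu_1, \nu_2$ be compactly supported Borel probability measures on $\mathbb{R}$, and let $\Sigma_{\nu_1}, \Sigma_{\nu_2}$ be the associated almost sure spectra (defined in the context). Then $$\mathrm{supp}\,\nu_1 \subseteq \mathrm{supp}\,\nu_2 \quad \Rightarrow \quad \Sigma_{\nu_1} \subseteq \Sigma_{\nu_2}.$$
   Context: A homeomorphism $T$ of $X$ is minimal if every orbit $\{T^n x : n \in \mathbb{Z}\}$ is dense in $X$. $\mathrm{supp}\,\nu$ denotes the topological support of $\nu$. For $x \in X$ and $\omega = (\omega_n)_{n\in\mathbb{Z}} \in (\mathrm{supp}\,\nu)^{\mathbb{Z}}$, let $H_\omega$ (depending also on $x$) be the operator on $\ell^2(\mathbb{Z})$ given by $[H_\omega \psi](n) = \psi(n+1) + \psi(n-1) + (f(T^n x) + \omega_n)\psi(n)$. Given $T$, $f$ and a compactly supported probability measure $\nu$ on $\mathbb{R}$, the almost sure spectrum $\Sigma_\nu \subset \mathbb{R}$ is the (existing and unique) compact set such that for every $x \in X$ and $\nu^{\mathbb{Z}}$-almost every $\omega$, $\sigma(H_\omega) = \Sigma_\nu$. *)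

theory Defs
  imports "HOL-Probability.Probability"
begin

section \<open>Minimal homeomorphisms\<close>

text \<open>Integer iterates; only meant for bijective \<open>T\<close>.\<close>

definition iterate_int :: "('a \<Rightarrow> 'a) \<Rightarrow> int \<Rightarrow> 'a \<Rightarrow> 'a" where
  "iterate_int T n = (if 0 \<le> n then T ^^ nat n else inv T ^^ nat (- n))"

definition minimal_homeomorphism :: "('a::topological_space \<Rightarrow> 'a) \<Rightarrow> bool" where
  "minimal_homeomorphism T \<longleftrightarrow>
     homeomorphism UNIV UNIV T (inv T) \<and>
     (\<forall>x. closure (range (\<lambda>n. iterate_int T n x)) = UNIV)"


section \<open>Compactly supported probability measures on the line\<close>

definition topological_support :: "'a::topological_space measure \<Rightarrow> 'a set" where
  "topological_support M = {x. \<forall>U. open U \<longrightarrow> x \<in> U \<longrightarrow> emeasure M U > 0}"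

definition compactly_supported_prob :: "real measure \<Rightarrow> bool" where
  "compactly_supported_prob \<nu> \<longleftrightarrow>
     prob_space \<nu> \<and> sets \<nu> = sets borel \<and> compact (topological_support \<nu>)"


section \<open>Operators on the Hilbert space of square-summable sequences\<close>

definition ell2 :: "(int \<Rightarrow> complex) set" where
  "ell2 = {\<psi>. (\<lambda>n. (cmod (\<psi> n))\<^sup>2) summable_on UNIV}"

definition ell2_norm :: "(int \<Rightarrow> complex) \<Rightarrow> real" where
  "ell2_norm \<psi> = sqrt (\<Sum>\<^sub>\<infinity>n. (cmod (\<psi> n))\<^sup>2)"

text \<open>Operators are functions on all sequences, of which only the restriction to
  \<^const>\<open>ell2\<close> matters.\<close>

definition ell2_bounded_operator :: "((int \<Rightarrow> complex) \<Rightarrow> int \<Rightarrow> complex) \<Rightarrow> bool" where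
  "ell2_bounded_operator A \<longleftrightarrow>
     (\<forall>\<psi>\<in>ell2. A \<psi> \<in> ell2) \<and>
     (\<forall>\<psi>\<in>ell2. \<forall>\<phi>\<in>ell2. A (\<lambda>n. \<psi> n + \<phi> n) = (\<lambda>n. A \<psi> n + A \<phi> n)) \<and>
     (\<forall>c. \<forall>\<psi>\<in>ell2. A (\<lambda>n. c * \<psi> n) = (\<lambda>n. c * A \<psi> n)) \<and>
     (\<exists>C. \<forall>\<psi>\<in>ell2. ell2_norm (A \<psi>) \<le> C * ell2_norm \<psi>)"

definition ell2_resolvent_set :: "((int \<Rightarrow> complex) \<Rightarrow> int \<Rightarrow> complex) \<Rightarrow> complex set" where
  "ell2_resolvent_set A =
     {z. \<exists>R. ell2_bounded_operator R \<and>
        (\<forall>\<psi>\<in>ell2. R (\<lambda>n. A \<psi> n - z * \<psi> n) = \<psi>) \<and>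
        (\<forall>\<psi>\<in>ell2. (\<lambda>n. A (R \<psi>) n - z * R \<psi> n) = \<psi>)}"

text \<open>Intended for bounded operators \<open>A\<close>.\<close>

definition ell2_spectrum :: "((int \<Rightarrow> complex) \<Rightarrow> int \<Rightarrow> complex) \<Rightarrow> complex set" where
  "ell2_spectrum A = - ell2_resolvent_set A"


section \<open>The random operators and their almost sure spectrum\<close>

definition random_schroedinger ::
  "('a \<Rightarrow> 'a) \<Rightarrow> ('a \<Rightarrow> real) \<Rightarrow> 'a \<Rightarrow> (int \<Rightarrow> real) \<Rightarrow> (int \<Rightarrow> complex) \<Rightarrow> int \<Rightarrow> complex" where
  "random_schroedinger T f x \<omega> \<psi> n =
     \<psi> (n + 1) + \<psi> (n - 1) + of_real (f (iterate_int T n x) + \<omega> n) * \<psi> n"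

text \<open>The product measure lives on all of \<open>int \<Rightarrow> real\<close>; almost every \<open>\<omega>\<close> takes its values
  in the support of \<open>\<nu>\<close>, so that the operator is bounded when the support is compact
  and \<open>f\<close> is bounded.\<close>

definition is_almost_sure_spectrum ::
  "('a \<Rightarrow> 'a) \<Rightarrow> ('a \<Rightarrow> real) \<Rightarrow> real measure \<Rightarrow> real set \<Rightarrow> bool" where
  "is_almost_sure_spectrum T f \<nu> S \<longleftrightarrow>
     compact S \<and>
     (\<forall>x. AE \<omega> in Pi\<^sub>M UNIV (\<lambda>_. \<nu>).
        ell2_spectrum (random_schroedinger T f x \<omega>) = complex_of_real ` S)"

definition almost_sure_spectrum ::
  "('a \<Rightarrow> 'a) \<Rightarrow> ('a \<Rightarrow> real) \<Rightarrow> real measure \<Rightarrow> real set" where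
  "almost_sure_spectrum T f \<nu> = (THE S. is_almost_sure_spectrum T f \<nu> S)"

end

theory Submission
  imports Defs
begin

text \<open>
  The almost sure spectrum is described by a set that depends on the measure only through its
  support, and visibly monotonically. Call a real number \<open>E\<close> an approximate energy for a set \<open>K\<close> of
  reals if for every \<open>\<epsilon> > 0\<close> some point \<open>y\<close>, some configuration \<open>\<eta>\<close> with values in \<open>K\<close> and some
  finitely supported \<open>\<psi>\<close> satisfy \<open>\<parallel>(H - E) \<psi>\<parallel> < \<epsilon> \<parallel>\<psi>\<parallel>\<close>, where \<open>H\<close> is the operator with potential
  \<open>f (T\<^sup>n y) + \<eta> n\<close>. A larger \<open>K\<close> allows more witnesses, so it has more approximate energies. It
  remains to see that the almost sure spectrum of \<open>\<nu>\<close> is the set of approximate energies for the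
  support of \<open>\<nu>\<close>; this includes its existence and uniqueness, without which the definite description
  in its definition would say nothing.

  The spectrum lies in this set as soon as \<open>\<omega>\<close> takes its values in the support, which it does almost
  surely. Indeed Weyl's criterion holds for bounded self-adjoint operators: the spectrum consists of
  the real \<open>E\<close> for which \<open>H - E\<close> is not bounded below
  (\<open>spectrum_iff_approximate_eigenvectors\<close>), and the approximate eigenvectors can be truncated to
  finite support. Behind the criterion is the completeness of \<open>\<ell>\<^sup>2\<close>, through a Lax-Milgram argument:
  an operator whose adjoint is bounded below is surjective (\<open>surj_if_adjoint_bounded_below\<close>).

  Conversely, let \<open>E\<close> be an approximate energy, with witnesses \<open>y\<close>, \<open>\<eta>\<close>, \<open>\<psi>\<close>, and let \<open>F\<close> be the
  support of \<open>\<psi>\<close>. By minimality and compactness the orbit of any \<open>x\<close> returns with bounded gaps to the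
  neighbourhood of \<open>y\<close> on which \<open>f \<circ> T\<^sup>n\<close>, for \<open>n\<close> in \<open>F\<close>, hardly changes. Choose return times
  along which the translates of \<open>F\<close> are disjoint. On these translates the values of \<open>\<omega>\<close> are
  independent, and on each of them they imitate \<open>\<eta>\<close> with the same positive probability; almost surely
  this happens at least once (\<open>AE_pattern_occurs\<close>). There the translate of \<open>\<psi>\<close> is an approximate
  eigenvector for \<open>x\<close> and \<open>\<omega>\<close>. The exceptional null set depends on \<open>E\<close> and \<open>\<epsilon>\<close>, but a countable dense
  set of energies and the values \<open>1 / (k + 1)\<close> of \<open>\<epsilon>\<close> suffice.
\<close>

section \<open>The Hilbert space of square-summable sequences\<close>

lemma ell2_iff: "\<psi> \<in> ell2 \<longleftrightarrow> (\<lambda>n. (cmod (\<psi> n))\<^sup>2) summable_on UNIV"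
  by (simp add: ell2_def)

lemma ell2_add:
  assumes "\<psi> \<in> ell2" "\<phi> \<in> ell2"
  shows "(\<lambda>n. \<psi> n + \<phi> n) \<in> ell2"
  unfolding ell2_iff
proof (rule summable_on_comparison_test)
  show "(\<lambda>n. 2 * (cmod (\<psi> n))\<^sup>2 + 2 * (cmod (\<phi> n))\<^sup>2) summable_on UNIV"
    using assms by (intro summable_on_add summable_on_cmult_right) (auto simp: ell2_iff)
  fix n
  have "(cmod (\<psi> n + \<phi> n))\<^sup>2 \<le> (cmod (\<psi> n) + cmod (\<phi> n))\<^sup>2"
    by (intro power_mono norm_triangle_ineq norm_ge_zero)
  also have "\<dots> \<le> 2 * (cmod (\<psi> n))\<^sup>2 + 2 * (cmod (\<phi> n))\<^sup>2"
    using sum_squares_bound[of "cmod (\<psi> n)" "cmod (\<phi> n)"] by (simp add: power2_sum)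
  finally show "(cmod (\<psi> n + \<phi> n))\<^sup>2 \<le> 2 * (cmod (\<psi> n))\<^sup>2 + 2 * (cmod (\<phi> n))\<^sup>2" .
qed auto

lemma ell2_bounded_mult:
  assumes "\<psi> \<in> ell2" and "\<And>n. \<psi> n \<noteq> 0 \<Longrightarrow> cmod (w n) \<le> C"
  shows "(\<lambda>n. w n * \<psi> n) \<in> ell2"
  unfolding ell2_iff
proof (rule summable_on_comparison_test)
  show "(\<lambda>n. C\<^sup>2 * (cmod (\<psi> n))\<^sup>2) summable_on UNIV"
    using assms by (intro summable_on_cmult_right) (auto simp: ell2_iff)
  show "(cmod (w n * \<psi> n))\<^sup>2 \<le> C\<^sup>2 * (cmod (\<psi> n))\<^sup>2" for n
    using assms(2)[of n]
    by (cases "\<psi> n = 0")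
      (auto simp: norm_mult power_mult_distrib intro!: mult_right_mono power_mono)
qed auto

lemma ell2_cmult: "\<psi> \<in> ell2 \<Longrightarrow> (\<lambda>n. c * \<psi> n) \<in> ell2"
  by (rule ell2_bounded_mult[where C = "cmod c"]) auto

lemma ell2_shift: "\<psi> \<in> ell2 \<Longrightarrow> (\<lambda>n. \<psi> (n + k)) \<in> ell2"
  unfolding ell2_iff
  using summable_on_reindex_bij_betw[of "\<lambda>n. n + k" UNIV UNIV "\<lambda>n. (cmod (\<psi> n))\<^sup>2"]
  by (simp add: bij_plus_right)

lemma ell2_inner_summable:
  assumes "\<psi> \<in> ell2" "\<phi> \<in> ell2"
  shows "(\<lambda>n. \<psi> n \<bullet> \<phi> n) summable_on UNIV"
proof -
  have "(\<lambda>n. norm (\<psi> n \<bullet> \<phi> n)) summable_on UNIV"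
  proof (rule summable_on_comparison_test)
    show "(\<lambda>n. (cmod (\<psi> n))\<^sup>2 + (cmod (\<phi> n))\<^sup>2) summable_on UNIV"
      using assms by (intro summable_on_add) (auto simp: ell2_iff)
    fix n
    have "\<bar>\<psi> n \<bullet> \<phi> n\<bar> \<le> cmod (\<psi> n) * cmod (\<phi> n)"
      by (rule Cauchy_Schwarz_ineq2)
    also have "\<dots> \<le> (cmod (\<psi> n))\<^sup>2 + (cmod (\<phi> n))\<^sup>2"
      using sum_squares_bound[of "cmod (\<psi> n)" "cmod (\<phi> n)"]
        mult_nonneg_nonneg[OF norm_ge_zero[of "\<psi> n"] norm_ge_zero[of "\<phi> n"]] by linarith
    finally show "norm (\<psi> n \<bullet> \<phi> n) \<le> (cmod (\<psi> n))\<^sup>2 + (cmod (\<phi> n))\<^sup>2" by simp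
  qed auto
  then show ?thesis by (rule abs_summable_summable)
qed

text \<open>A type of its own makes \<^const>\<open>ell2\<close> a real Hilbert space for the type classes. Its inner product is
  the real part of the complex one, so complex multiples act as operators rather than as scalars;
  symmetry and bounds from below lose nothing in this reading.\<close>

typedef l2 = "ell2" morphisms coord l2_of
  by (rule exI[of _ "\<lambda>_. 0"]) (simp add: ell2_iff)

setup_lifting type_definition_l2

instantiation l2 :: real_inner
begin

lift_definition zero_l2 :: l2 is "\<lambda>_. 0" by (simp add: ell2_iff)
lift_definition plus_l2 :: "l2 \<Rightarrow> l2 \<Rightarrow> l2" is "\<lambda>\<psi> \<phi> n. \<psi> n + \<phi> n" by (rule ell2_add)
lift_definition uminus_l2 :: "l2 \<Rightarrow> l2" is "\<lambda>\<psi> n. - \<psi> n" by (simp add: ell2_iff)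
lift_definition minus_l2 :: "l2 \<Rightarrow> l2 \<Rightarrow> l2" is "\<lambda>\<psi> \<phi> n. \<psi> n - \<phi> n"
  using ell2_add[OF _ ell2_cmult[of _ "-1"]] by simp
lift_definition scaleR_l2 :: "real \<Rightarrow> l2 \<Rightarrow> l2" is "\<lambda>r \<psi> n. r *\<^sub>R \<psi> n"
  unfolding scaleR_conv_of_real by (rule ell2_cmult)
lift_definition inner_l2 :: "l2 \<Rightarrow> l2 \<Rightarrow> real" is "\<lambda>\<psi> \<phi>. \<Sum>\<^sub>\<infinity>n. \<psi> n \<bullet> \<phi> n" .
definition "norm_l2 (\<psi> :: l2) = sqrt (\<psi> \<bullet> \<psi>)"
definition "sgn_l2 (\<psi> :: l2) = inverse (norm \<psi>) *\<^sub>R \<psi>"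
definition "dist_l2 (\<psi> :: l2) \<phi> = norm (\<psi> - \<phi>)"
definition uniformity_l2 :: "(l2 \<times> l2) filter"
  where "uniformity_l2 = (INF e\<in>{0<..}. principal {(x, y). dist x y < e})"
definition open_l2 :: "l2 set \<Rightarrow> bool"
  where "open_l2 U = (\<forall>x\<in>U. \<forall>\<^sub>F (x', y) in uniformity. x' = x \<longrightarrow> y \<in> U)"

instance
proof
  fix a b c :: l2 and r s :: real and U :: "l2 set"
  show "a + b + c = a + (b + c)" by transfer (rule ext, rule add.assoc)
  show "a + b = b + a" by transfer (rule ext, rule add.commute)
  show "0 + a = a" "- a + a = 0" "a - b = a + - b" by (transfer, simp)+
  show "r *\<^sub>R (a + b) = r *\<^sub>R a + r *\<^sub>R b" by transfer (rule ext, rule scaleR_add_right)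
  show "(r + s) *\<^sub>R a = r *\<^sub>R a + s *\<^sub>R a" by transfer (rule ext, rule scaleR_add_left)
  show "r *\<^sub>R s *\<^sub>R a = (r * s) *\<^sub>R a" "1 *\<^sub>R a = a" by (transfer, simp)+
  show "dist a b = norm (a - b)" "sgn a = inverse (norm a) *\<^sub>R a" "norm a = sqrt (a \<bullet> a)"
    by (simp_all add: dist_l2_def sgn_l2_def norm_l2_def)
  show "uniformity = (INF e\<in>{0<..}. principal {(x, y :: l2). dist x y < e})"
    by (rule uniformity_l2_def)
  show "open U = (\<forall>x\<in>U. \<forall>\<^sub>F (x', y) in uniformity. x' = x \<longrightarrow> y \<in> U)"
    by (rule open_l2_def)
  note summable = ell2_inner_summable[OF coord coord]
  show "a \<bullet> b = b \<bullet> a"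
    unfolding inner_l2.rep_eq by (simp only: inner_commute)
  show "(a + b) \<bullet> c = a \<bullet> c + b \<bullet> c"
    unfolding inner_l2.rep_eq plus_l2.rep_eq inner_add_left by (intro infsum_add summable)
  show "(r *\<^sub>R a) \<bullet> b = r * (a \<bullet> b)"
    unfolding inner_l2.rep_eq scaleR_l2.rep_eq inner_scaleR_left by (rule infsum_cmult_right')
  show "0 \<le> a \<bullet> a"
    unfolding inner_l2.rep_eq by (rule infsum_nonneg, rule inner_ge_zero)
  show "a \<bullet> a = 0 \<longleftrightarrow> a = 0"
  proof
    assume "a \<bullet> a = 0"
    then have "coord a n \<bullet> coord a n = 0" for n
      by (intro nonneg_infsum_le_0D[OF _ summable])
        (simp_all only: inner_l2.rep_eq inner_ge_zero order.refl UNIV_I)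
    then have "coord a = coord 0"
      by (simp only: inner_eq_zero_iff zero_l2.rep_eq fun_eq_iff simp_thms)
    then show "a = 0" by (simp only: coord_inject)
  next
    assume "a = 0"
    then show "a \<bullet> a = 0" by (simp only: inner_l2.rep_eq zero_l2.rep_eq inner_zero_left infsum_0)
  qed
qed

end

lemma l2_norm_sq: "(norm \<psi>)\<^sup>2 = (\<Sum>\<^sub>\<infinity>n. (cmod (coord \<psi> n))\<^sup>2)"
  by (simp add: power2_norm_eq_inner inner_l2.rep_eq)

lemma l2_norm_eq: "norm \<psi> = ell2_norm (coord \<psi>)"
  unfolding ell2_norm_def l2_norm_sq[symmetric] by simp

lemma coord_summable: "(\<lambda>n. (cmod (coord \<psi> n))\<^sup>2) summable_on UNIV"
  using coord[of \<psi>] by (simp add: ell2_iff)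

lemma finite_sum_le_l2_norm_sq:
  "finite F \<Longrightarrow> (\<Sum>n\<in>F. (cmod (coord \<psi> n))\<^sup>2) \<le> (norm \<psi>)\<^sup>2"
  unfolding l2_norm_sq by (rule finite_sum_le_infsum) (auto simp: coord_summable)

lemma coord_le_norm: "cmod (coord \<psi> n) \<le> norm \<psi>"
  using finite_sum_le_l2_norm_sq[of "{n}" \<psi>] by (simp add: power2_le_iff_abs_le)

lemma l2_norm_le:
  assumes "\<And>F. finite F \<Longrightarrow> (\<Sum>n\<in>F. (cmod (coord \<psi> n))\<^sup>2) \<le> C\<^sup>2" "0 \<le> C"
  shows "norm \<psi> \<le> C"
proof (rule power2_le_imp_le)
  show "(norm \<psi>)\<^sup>2 \<le> C\<^sup>2"
    unfolding l2_norm_sq by (rule infsum_le_finite_sums) (use assms coord_summable in auto)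
qed fact

text \<open>A Cauchy sequence converges in each coordinate. Bounds on finite partial sums pass to the
  coordinatewise limit, first to show that it is square-summable and then that the convergence is in
  norm.\<close>

instance l2 :: complete_space
proof
  fix X :: "nat \<Rightarrow> l2"
  assume X: "Cauchy X"
  have diff: "coord (\<psi> - \<phi>) n = coord \<psi> n - coord \<phi> n" for \<psi> \<phi> n by (simp add: minus_l2.rep_eq)
  have "Cauchy (\<lambda>k. coord (X k) n)" for n
  proof (rule metric_CauchyI)
    fix e :: real assume "e > 0"
    then obtain M where M: "\<forall>k\<ge>M. \<forall>m\<ge>M. dist (X k) (X m) < e"
      using metric_CauchyD[OF X] by blast
    have "dist (coord (X k) n) (coord (X m) n) \<le> dist (X k) (X m)" for k m
      using coord_le_norm[of "X k - X m" n] by (simp add: dist_norm diff)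
    then show "\<exists>M. \<forall>k\<ge>M. \<forall>m\<ge>M. dist (coord (X k) n) (coord (X m) n) < e"
      using M by (intro exI[of _ M]) (metis order.strict_trans1)
  qed
  then obtain \<phi> where \<phi>: "\<And>n. (\<lambda>k. coord (X k) n) \<longlonglongrightarrow> \<phi> n"
    using that[of "\<lambda>n. lim (\<lambda>k. coord (X k) n)"]
    by (simp add: Cauchy_convergent_iff convergent_LIMSEQ_iff)
  obtain B where B: "\<And>k. norm (X k) \<le> B"
    using Cauchy_Bseq[OF X] unfolding Bseq_def by blast
  have "(\<Sum>n\<in>F. (cmod (\<phi> n))\<^sup>2) \<le> B\<^sup>2" if "finite F" for F
  proof (rule LIMSEQ_le_const2)
    show "(\<lambda>k. \<Sum>n\<in>F. (cmod (coord (X k) n))\<^sup>2) \<longlonglongrightarrow> (\<Sum>n\<in>F. (cmod (\<phi> n))\<^sup>2)"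
      by (intro tendsto_intros \<phi>)
    have "(\<Sum>n\<in>F. (cmod (coord (X k) n))\<^sup>2) \<le> B\<^sup>2" for k
      using finite_sum_le_l2_norm_sq[OF that, of "X k"] power_mono[OF B, of k 2] by simp
    then show "\<exists>N. \<forall>k\<ge>N. (\<Sum>n\<in>F. (cmod (coord (X k) n))\<^sup>2) \<le> B\<^sup>2"
      by blast
  qed
  then have "\<phi> \<in> ell2"
    unfolding ell2_iff
    by (intro nonneg_bdd_above_summable_on bdd_aboveI[where M = "B\<^sup>2"]) fastforce+
  then have coord_\<phi>: "coord (l2_of \<phi>) = \<phi>"
    by (rule l2_of_inverse)
  have "X \<longlonglongrightarrow> l2_of \<phi>"
  proof (rule metric_LIMSEQ_I)
    fix e :: real assume e: "e > 0"
    then obtain M where M: "\<forall>k\<ge>M. \<forall>m\<ge>M. dist (X k) (X m) < e / 2"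
      using metric_CauchyD[OF X, of "e / 2"] by auto
    have "dist (X k) (l2_of \<phi>) < e" if "k \<ge> M" for k
    proof -
      have "norm (X k - l2_of \<phi>) \<le> e / 2"
      proof (rule l2_norm_le)
        fix F :: "int set" assume F: "finite F"
        show "(\<Sum>n\<in>F. (cmod (coord (X k - l2_of \<phi>) n))\<^sup>2) \<le> (e / 2)\<^sup>2"
        proof (rule LIMSEQ_le_const2)
          show "(\<lambda>m. \<Sum>n\<in>F. (cmod (coord (X k - X m) n))\<^sup>2)
              \<longlonglongrightarrow> (\<Sum>n\<in>F. (cmod (coord (X k - l2_of \<phi>) n))\<^sup>2)"
            unfolding diff coord_\<phi> by (intro tendsto_intros \<phi>)
          have "(\<Sum>n\<in>F. (cmod (coord (X k - X m) n))\<^sup>2) \<le> (e / 2)\<^sup>2" if "m \<ge> M" for m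
          proof -
            have "norm (X k - X m) \<le> e / 2"
              using M \<open>k \<ge> M\<close> that by (simp add: dist_norm less_imp_le)
            then show ?thesis
              using finite_sum_le_l2_norm_sq[OF F, of "X k - X m"]
                power_mono[of "norm (X k - X m)" "e / 2" 2] by simp
          qed
          then show "\<exists>N. \<forall>m\<ge>N. (\<Sum>n\<in>F. (cmod (coord (X k - X m) n))\<^sup>2) \<le> (e / 2)\<^sup>2"
            by blast
        qed
      qed (use e in simp)
      then show ?thesis using e by (simp add: dist_norm)
    qed
    then show "\<exists>M. \<forall>k\<ge>M. dist (X k) (l2_of \<phi>) < e" by blast
  qed
  then show "convergent X" by (auto simp: convergent_def)
qed

lemma l2_eqI: "(\<And>n. coord \<psi> n = coord \<phi> n) \<Longrightarrow> \<psi> = \<phi>"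
  by (metis coord_inject ext)

lemmas coord_simps = zero_l2.rep_eq plus_l2.rep_eq uminus_l2.rep_eq minus_l2.rep_eq
  scaleR_l2.rep_eq

lift_definition shift_l2 :: "int \<Rightarrow> l2 \<Rightarrow> l2" is "\<lambda>k \<psi> n. \<psi> (n + k)"
  by (rule ell2_shift)

lemma inner_shift_l2: "shift_l2 k \<psi> \<bullet> \<phi> = \<psi> \<bullet> shift_l2 (- k) \<phi>"
  using infsum_reindex_bij_betw[of "\<lambda>n. n + k" UNIV UNIV
      "\<lambda>n. coord \<psi> n \<bullet> coord \<phi> (n - k)"]
  by (simp add: inner_l2.rep_eq shift_l2.rep_eq bij_plus_right)

lemma norm_shift_l2: "norm (shift_l2 k \<psi>) = norm \<psi>"
proof -
  have "shift_l2 (- k) (shift_l2 k \<psi>) = \<psi>"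
    by (rule l2_eqI) (simp add: shift_l2.rep_eq)
  then show ?thesis
    by (simp add: norm_eq_sqrt_inner inner_shift_l2)
qed

text \<open>The value is meaningful when \<open>w\<close> is bounded where \<open>\<psi>\<close> does not vanish; this covers bounded \<open>w\<close> and
  also arbitrary \<open>w\<close> for finitely supported \<open>\<psi>\<close>.\<close>

definition mult_l2 :: "(int \<Rightarrow> complex) \<Rightarrow> l2 \<Rightarrow> l2"
  where "mult_l2 w \<psi> = l2_of (\<lambda>n. w n * coord \<psi> n)"

lemma coord_mult_l2:
  assumes "\<And>n. coord \<psi> n \<noteq> 0 \<Longrightarrow> cmod (w n) \<le> C"
  shows "coord (mult_l2 w \<psi>) n = w n * coord \<psi> n"
  unfolding mult_l2_def using l2_of_inverse[OF ell2_bounded_mult[OF coord, of \<psi> w C]] assms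
  by simp

lemma coord_mult_l2_bounded:
  "bounded (range w) \<Longrightarrow> coord (mult_l2 w \<psi>) n = w n * coord \<psi> n"
  by (auto simp: bounded_iff intro: coord_mult_l2)

lemma norm_mult_l2:
  assumes w: "\<And>n. coord \<psi> n \<noteq> 0 \<Longrightarrow> cmod (w n) \<le> C" and "0 \<le> C"
  shows "norm (mult_l2 w \<psi>) \<le> C * norm \<psi>"
proof (rule l2_norm_le)
  have coord: "coord (mult_l2 w \<psi>) n = w n * coord \<psi> n" for n
    using w by (rule coord_mult_l2)
  fix F :: "int set" assume F: "finite F"
  have "(\<Sum>n\<in>F. (cmod (coord (mult_l2 w \<psi>) n))\<^sup>2) \<le> (\<Sum>n\<in>F. C\<^sup>2 * (cmod (coord \<psi> n))\<^sup>2)"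
  proof (rule sum_mono)
    fix n
    show "(cmod (coord (mult_l2 w \<psi>) n))\<^sup>2 \<le> C\<^sup>2 * (cmod (coord \<psi> n))\<^sup>2"
      using w[of n] unfolding coord
      by (cases "coord \<psi> n = 0")
        (auto simp: norm_mult power_mult_distrib intro!: mult_right_mono power_mono)
  qed
  also have "\<dots> \<le> (C * norm \<psi>)\<^sup>2"
    using finite_sum_le_l2_norm_sq[OF F, of \<psi>]
    by (simp add: power_mult_distrib mult_left_mono flip: sum_distrib_left)
  finally show "(\<Sum>n\<in>F. (cmod (coord (mult_l2 w \<psi>) n))\<^sup>2) \<le> (C * norm \<psi>)\<^sup>2" .
qed (use assms in simp)

lemma inner_mult_l2:
  assumes "bounded (range w)"
  shows "mult_l2 w \<psi> \<bullet> \<phi> = \<psi> \<bullet> mult_l2 (\<lambda>n. cnj (w n)) \<phi>"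
proof -
  have "bounded (range (\<lambda>n. cnj (w n)))"
    using assms by (simp add: bounded_iff)
  then show ?thesis
    using assms
    by (auto simp: inner_l2.rep_eq coord_mult_l2_bounded inner_complex_def algebra_simps
        intro!: infsum_cong)
qed

section \<open>Operators with an adjoint bounded below\<close>

text \<open>If \<open>B\<close> is adjoint to \<open>A\<close> and bounded below, then \<open>A B\<close> is coercive, so for small \<open>t > 0\<close> the map
  \<open>x \<mapsto> x - t (A B x - y)\<close> is a contraction; \<open>B\<close> of its fixed point is a preimage of \<open>y\<close>. This replaces
  an orthogonal complement of the range by Banach's fixed point theorem.\<close>

lemma surj_if_adjoint_bounded_below:
  fixes A B :: "'a::{real_inner, complete_space} \<Rightarrow> 'a"
  assumes A: "bounded_linear A" and B: "bounded_linear B"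
    and adj: "\<And>x y. A x \<bullet> y = x \<bullet> B y"
    and c: "c > 0" "\<And>x. c * norm x \<le> norm (B x)"
  shows "surj A"
proof -
  have AB: "bounded_linear (\<lambda>x. A (B x))"
    using bounded_linear_compose[OF A B] .
  obtain K where K: "K > 0" "\<And>x. norm (A (B x)) \<le> norm x * K"
    using bounded_linear.pos_bounded[OF AB] by blast
  have coercive: "c\<^sup>2 * (norm x)\<^sup>2 \<le> A (B x) \<bullet> x" for x
    using power_mono[OF c(2), of x 2] c(1)
    by (simp add: adj power_mult_distrib power2_norm_eq_inner)
  \<comment> \<open>This \<open>t\<close> minimises the bound \<open>1 - 2 t c\<^sup>2 + t\<^sup>2 K\<^sup>2\<close> on the squared contraction factor;
    \<open>q\<close> is the minimum.\<close>
  define t where "t = c\<^sup>2 / K\<^sup>2"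
  define q where "q = 1 - c^4 / K\<^sup>2"
  have t: "t > 0" using c K by (simp add: t_def)
  have contract: "(norm (x - t *\<^sub>R A (B x)))\<^sup>2 \<le> q * (norm x)\<^sup>2" for x
  proof -
    have tx: "t *\<^sub>R A (B x) \<bullet> x = t * (A (B x) \<bullet> x)" by simp
    have "(norm (x - t *\<^sub>R A (B x)))\<^sup>2
        = (norm x)\<^sup>2 - 2 * t * (A (B x) \<bullet> x) + t\<^sup>2 * (norm (A (B x)))\<^sup>2"
      using tx unfolding power2_norm_eq_inner
      by (simp add: inner_diff inner_commute[of x "A (B x)"] power2_eq_square algebra_simps)
    also have "\<dots> \<le> (norm x)\<^sup>2 - 2 * t * (c\<^sup>2 * (norm x)\<^sup>2) + t\<^sup>2 * (norm x * K)\<^sup>2"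
      using t K(2)[of x] coercive[of x]
      by (intro add_mono diff_mono mult_left_mono power_mono order.refl) simp_all
    also have "\<dots> = q * (norm x)\<^sup>2"
      unfolding t_def q_def using K(1) by (simp add: field_simps power2_eq_square power4_eq_xxxx)
    finally show ?thesis .
  qed
  have "\<exists>x. A x = y" for y
  proof -
    define g where "g x = x - t *\<^sub>R (A (B x) - y)" for x
    \<comment> \<open>In the zero space \<open>q\<close> may be negative.\<close>
    have "dist (g x) (g x') \<le> sqrt (max 0 q) * dist x x'" for x x'
    proof -
      have "g x - g x' = (x - x') - t *\<^sub>R A (B (x - x'))"
        by (simp add: g_def linear_diff[OF bounded_linear.linear[OF AB]] algebra_simps)
      then have "(norm (g x - g x'))\<^sup>2 \<le> max 0 q * (norm (x - x'))\<^sup>2"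
        using contract[of "x - x'"] mult_right_mono[of q "max 0 q" "(norm (x - x'))\<^sup>2"] by simp
      then have "norm (g x - g x') \<le> sqrt (max 0 q * (norm (x - x'))\<^sup>2)"
        by (rule real_le_rsqrt)
      then show ?thesis
        by (simp add: dist_norm real_sqrt_mult)
    qed
    moreover have "q < 1"
      using c K by (simp add: q_def)
    ultimately have "\<exists>!x. g x = x"
      by (intro banach_fix_type[of "sqrt (max 0 q)"]) auto
    then obtain x where "g x = x" by blast
    then have "A (B x) = y" using t by (simp add: g_def)
    then show ?thesis by blast
  qed
  then show ?thesis by (metis surjI)
qed

section \<open>Discrete Schroedinger operators and Weyl's criterion\<close>

definition discrete_schroedinger :: "(int \<Rightarrow> real) \<Rightarrow> (int \<Rightarrow> complex) \<Rightarrow> int \<Rightarrow> complex"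
  where "discrete_schroedinger V \<psi> n = \<psi> (n + 1) + \<psi> (n - 1) + of_real (V n) * \<psi> n"

text \<open>The discrete Schroedinger operator minus \<open>z\<close>, with the spectral parameter absorbed in the
  multiplication operator; meant for bounded \<open>V\<close>.\<close>

definition schroedinger_l2 :: "(int \<Rightarrow> real) \<Rightarrow> complex \<Rightarrow> l2 \<Rightarrow> l2"
  where "schroedinger_l2 V z \<psi> =
    shift_l2 1 \<psi> + shift_l2 (- 1) \<psi> + mult_l2 (\<lambda>n. of_real (V n) - z) \<psi>"

lemma bounded_potential_minus:
  assumes "bounded (range V)"
  shows "bounded (range (\<lambda>n. complex_of_real (V n) - z))"
proof -
  obtain C where C: "\<And>n. \<bar>V n\<bar> \<le> C" using assms by (auto simp: bounded_iff)
  have "cmod (complex_of_real (V n) - z) \<le> C + cmod z" for n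
    using norm_triangle_ineq4[of "complex_of_real (V n)" z] C[of n] by simp
  then show ?thesis by (auto simp: bounded_iff)
qed

lemma coord_schroedinger_l2:
  assumes "bounded (range V)"
  shows "coord (schroedinger_l2 V z \<psi>) n = discrete_schroedinger V (coord \<psi>) n - z * coord \<psi> n"
  unfolding schroedinger_l2_def discrete_schroedinger_def
  by (simp add: coord_simps shift_l2.rep_eq coord_mult_l2_bounded[OF bounded_potential_minus[OF assms]]
      algebra_simps)

lemma norm_schroedinger_l2_le:
  assumes "\<And>n. \<bar>V n\<bar> \<le> C"
  shows "norm (schroedinger_l2 V z \<psi>) \<le> (2 + (C + cmod z)) * norm \<psi>"
proof -
  have "cmod (complex_of_real (V n) - z) \<le> C + cmod z" for n
    using norm_triangle_ineq4[of "complex_of_real (V n)" z] assms[of n] by simp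
  moreover have "0 \<le> C + cmod z"
    using assms[of 0] by (smt (verit) norm_ge_zero)
  ultimately have "norm (mult_l2 (\<lambda>n. of_real (V n) - z) \<psi>) \<le> (C + cmod z) * norm \<psi>"
    by (intro norm_mult_l2)
  moreover have "norm (schroedinger_l2 V z \<psi>) \<le>
      norm (shift_l2 1 \<psi>) + norm (shift_l2 (- 1) \<psi>) + norm (mult_l2 (\<lambda>n. of_real (V n) - z) \<psi>)"
    unfolding schroedinger_l2_def
    by (intro order.trans[OF norm_triangle_ineq] add_mono norm_triangle_ineq order.refl)
  ultimately show ?thesis
    by (simp add: norm_shift_l2 algebra_simps)
qed

lemma bounded_linear_schroedinger_l2:
  assumes "bounded (range V)"
  shows "bounded_linear (schroedinger_l2 V z)"
proof -
  obtain C where C: "\<And>n. \<bar>V n\<bar> \<le> C" using assms by (auto simp: bounded_iff)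
  show ?thesis
  proof (rule bounded_linear_intro)
    show "norm (schroedinger_l2 V z \<psi>) \<le> norm \<psi> * (2 + (C + cmod z))" for \<psi>
      using norm_schroedinger_l2_le[OF C] by (simp add: mult.commute)
  qed (auto intro!: l2_eqI simp: coord_simps coord_schroedinger_l2[OF assms]
      discrete_schroedinger_def scaleR_conv_of_real algebra_simps)
qed

lemma inner_schroedinger_l2:
  assumes "bounded (range V)"
  shows "schroedinger_l2 V z \<psi> \<bullet> \<phi> = \<psi> \<bullet> schroedinger_l2 V (cnj z) \<phi>"
  unfolding schroedinger_l2_def
  by (simp add: inner_add_left inner_add_right inner_shift_l2
      inner_mult_l2[OF bounded_potential_minus[OF assms]])

lemma schroedinger_l2_energy_change:
  assumes "bounded (range V)"
  shows "schroedinger_l2 V z' \<psi> = schroedinger_l2 V z \<psi> + mult_l2 (\<lambda>_. z - z') \<psi>"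
  by (rule l2_eqI) (simp add: coord_simps coord_schroedinger_l2[OF assms]
      coord_mult_l2_bounded algebra_simps)

text \<open>Multiplication \<open>J\<close> by the imaginary unit is skew and commutes with the symmetric \<open>A = H - Re z\<close>, so
  \<open>A \<psi>\<close> and \<open>J \<psi>\<close> are orthogonal and
  \<open>\<parallel>(H - z) \<psi>\<parallel>\<^sup>2 = \<parallel>A \<psi>\<parallel>\<^sup>2 + (Im z)\<^sup>2 \<parallel>\<psi>\<parallel>\<^sup>2\<close>.\<close>

lemma nonreal_energy_bounded_below:
  assumes V: "bounded (range V)"
  shows "\<bar>Im z\<bar> * norm \<psi> \<le> norm (schroedinger_l2 V z \<psi>)"
proof -
  define A where "A = schroedinger_l2 V (of_real (Re z))"
  define J where "J = mult_l2 (\<lambda>_. \<i>)"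
  have coord_J: "coord (J \<phi>) n = \<i> * coord \<phi> n" for \<phi> n
    by (simp add: J_def coord_mult_l2_bounded)
  have J_skew: "J \<phi> \<bullet> \<eta> = - (\<phi> \<bullet> J \<eta>)" for \<phi> \<eta>
  proof -
    have "mult_l2 (\<lambda>_. - \<i>) \<eta> = - J \<eta>"
      by (rule l2_eqI) (simp add: coord_simps coord_J coord_mult_l2_bounded)
    then show ?thesis by (simp add: J_def inner_mult_l2)
  qed
  have JA: "A (J \<phi>) = J (A \<phi>)" for \<phi>
    by (rule l2_eqI)
      (simp add: A_def coord_J coord_schroedinger_l2[OF V] discrete_schroedinger_def algebra_simps)
  have A_sym: "A \<phi> \<bullet> \<eta> = \<phi> \<bullet> A \<eta>" for \<phi> \<eta>
    by (simp add: A_def inner_schroedinger_l2[OF V])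
  have "J (A \<psi>) \<bullet> \<psi> = - (A \<psi> \<bullet> J \<psi>)" by (rule J_skew)
  moreover have "J (A \<psi>) \<bullet> \<psi> = J \<psi> \<bullet> A \<psi>" by (simp add: A_sym flip: JA)
  ultimately have orth: "A \<psi> \<bullet> J \<psi> = 0" by (simp add: inner_commute)
  have "J (J \<psi>) = - \<psi>" by (rule l2_eqI) (simp add: coord_simps coord_J)
  then have norm_J: "J \<psi> \<bullet> J \<psi> = (norm \<psi>)\<^sup>2"
    by (simp add: J_skew power2_norm_eq_inner)
  have "schroedinger_l2 V z \<psi> = A \<psi> - Im z *\<^sub>R J \<psi>"
    by (rule l2_eqI)
      (simp add: A_def coord_simps coord_J coord_schroedinger_l2[OF V] scaleR_conv_of_real
        complex_eq_iff algebra_simps)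
  then have "(norm (schroedinger_l2 V z \<psi>))\<^sup>2 = (norm (A \<psi>))\<^sup>2 + (Im z)\<^sup>2 * (norm \<psi>)\<^sup>2"
    using orth norm_J inner_commute[of "J \<psi>" "A \<psi>"] unfolding power2_norm_eq_inner
    by (simp add: inner_diff_left inner_diff_right power2_eq_square)
  then have "(\<bar>Im z\<bar> * norm \<psi>)\<^sup>2 \<le> (norm (schroedinger_l2 V z \<psi>))\<^sup>2"
    by (simp add: power_mult_distrib)
  then show ?thesis by (rule power2_le_imp_le) simp
qed

text \<open>The bound for \<open>z\<close> gives injectivity and the boundedness of the inverse, the bound for the
  adjoint, which belongs to \<open>cnj z\<close>, gives surjectivity.\<close>

lemma resolvent_set_if_bounded_below:
  assumes V: "bounded (range V)" and c: "c > 0"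
    and z: "\<And>\<psi>. c * norm \<psi> \<le> norm (schroedinger_l2 V z \<psi>)"
    and z': "\<And>\<psi>. c * norm \<psi> \<le> norm (schroedinger_l2 V (cnj z) \<psi>)"
  shows "z \<in> ell2_resolvent_set (discrete_schroedinger V)"
proof -
  let ?A = "schroedinger_l2 V z"
  note bl = bounded_linear_schroedinger_l2[OF V]
  have lin: "linear ?A" using bounded_linear.linear[OF bl] .
  have surj: "surj ?A"
    by (rule surj_if_adjoint_bounded_below[OF bl bl inner_schroedinger_l2[OF V] c z'])
  have "inj ?A"
  proof (rule injI)
    fix \<psi> \<phi> assume "?A \<psi> = ?A \<phi>"
    then have "?A (\<psi> - \<phi>) = 0" by (simp add: linear_diff[OF lin])
    then have "c * norm (\<psi> - \<phi>) \<le> 0" using z[of "\<psi> - \<phi>"] by simp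
    then have "norm (\<psi> - \<phi>) \<le> 0" using c by (simp add: mult_le_0_iff)
    then show "\<psi> = \<phi>" by simp
  qed
  define B where "B = inv ?A"
  have AB: "?A (B \<phi>) = \<phi>" for \<phi> using surj by (simp add: B_def surj_f_inv_f)
  have BA: "B (?A \<phi>) = \<phi>" for \<phi> using \<open>inj ?A\<close> by (simp add: B_def inv_f_f)
  define R where "R \<phi> = coord (B (l2_of \<phi>))" for \<phi>
  have A_mult: "?A (mult_l2 (\<lambda>_. a) \<phi>) = mult_l2 (\<lambda>_. a) (?A \<phi>)" for a \<phi>
    by (rule l2_eqI) (simp add: coord_mult_l2_bounded coord_schroedinger_l2[OF V]
        discrete_schroedinger_def algebra_simps)
  have B_add: "B (\<psi> + \<phi>) = B \<psi> + B \<phi>" for \<psi> \<phi>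
    by (metis AB BA linear_add[OF lin])
  have B_mult: "B (mult_l2 (\<lambda>_. a) \<phi>) = mult_l2 (\<lambda>_. a) (B \<phi>)" for a \<phi>
    by (metis AB BA A_mult)
  have "ell2_bounded_operator R"
    unfolding ell2_bounded_operator_def
  proof (intro conjI ballI allI)
    show "R \<psi> \<in> ell2" for \<psi> by (simp add: R_def coord)
    show "R (\<lambda>n. \<psi> n + \<phi> n) = (\<lambda>n. R \<psi> n + R \<phi> n)" if "\<psi> \<in> ell2" "\<phi> \<in> ell2" for \<psi> \<phi>
    proof -
      have "l2_of (\<lambda>n. \<psi> n + \<phi> n) = l2_of \<psi> + l2_of \<phi>"
        by (rule l2_eqI) (simp add: l2_of_inverse that ell2_add coord_simps)
      then show ?thesis by (simp add: R_def B_add coord_simps)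
    qed
    show "R (\<lambda>n. a * \<psi> n) = (\<lambda>n. a * R \<psi> n)" if "\<psi> \<in> ell2" for a \<psi>
    proof -
      have "l2_of (\<lambda>n. a * \<psi> n) = mult_l2 (\<lambda>_. a) (l2_of \<psi>)"
        by (simp add: mult_l2_def l2_of_inverse that)
      then show ?thesis by (auto simp: R_def B_mult coord_mult_l2_bounded)
    qed
    have "norm (B \<psi>) \<le> inverse c * norm \<psi>" for \<psi>
      using z[of "B \<psi>"] c by (simp add: AB field_simps)
    then show "\<exists>C. \<forall>\<psi>\<in>ell2. ell2_norm (R \<psi>) \<le> C * ell2_norm \<psi>"
      by (intro exI[of _ "inverse c"]) (metis R_def l2_norm_eq l2_of_inverse)
  qed
  moreover have "l2_of (\<lambda>n. discrete_schroedinger V (coord \<psi>) n - z * coord \<psi> n) = ?A \<psi>" for \<psi>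
    by (metis (no_types, lifting) coord_inverse coord_schroedinger_l2[OF V] ext)
  then have "R (\<lambda>n. discrete_schroedinger V \<psi> n - z * \<psi> n) = \<psi>" if "\<psi> \<in> ell2" for \<psi>
    using l2_of_inverse[OF that] BA by (metis R_def)
  moreover have "(\<lambda>n. discrete_schroedinger V (R \<psi>) n - z * R \<psi> n) = \<psi>" if "\<psi> \<in> ell2" for \<psi>
    by (rule ext) (simp add: R_def AB l2_of_inverse that flip: coord_schroedinger_l2[OF V])
  ultimately show ?thesis
    unfolding ell2_resolvent_set_def by blast
qed

lemma bounded_below_if_resolvent_set:
  assumes V: "bounded (range V)" and z: "z \<in> ell2_resolvent_set (discrete_schroedinger V)"
  obtains C where "C > 0" "\<And>\<psi>. norm \<psi> \<le> C * norm (schroedinger_l2 V z \<psi>)"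
proof -
  obtain R C where C: "\<And>\<psi>. \<psi> \<in> ell2 \<Longrightarrow> ell2_norm (R \<psi>) \<le> C * ell2_norm \<psi>"
    and R: "\<And>\<psi>. \<psi> \<in> ell2 \<Longrightarrow> R (\<lambda>n. discrete_schroedinger V \<psi> n - z * \<psi> n) = \<psi>"
    using z unfolding ell2_resolvent_set_def ell2_bounded_operator_def by blast
  have "norm \<psi> \<le> max C 1 * norm (schroedinger_l2 V z \<psi>)" for \<psi>
  proof -
    have "R (coord (schroedinger_l2 V z \<psi>)) = coord \<psi>"
      using R[OF coord[of \<psi>]] by (simp add: coord_schroedinger_l2[OF V, abs_def])
    then have "norm \<psi> \<le> C * norm (schroedinger_l2 V z \<psi>)"
      using C[OF coord, of "schroedinger_l2 V z \<psi>"] by (simp add: l2_norm_eq)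
    also have "\<dots> \<le> max C 1 * norm (schroedinger_l2 V z \<psi>)"
      by (intro mult_right_mono) auto
    finally show ?thesis .
  qed
  then show thesis by (intro that[of "max C 1"]) auto
qed

text \<open>Weyl's criterion. For real \<open>z\<close> the operator is its own adjoint, so a bound from below already makes
  it invertible; nonreal \<open>z\<close> always have such a bound. An approximate eigenvector that is too good
  contradicts a bounded inverse.\<close>

lemma spectrum_iff_approximate_eigenvectors:
  assumes V: "bounded (range V)"
  shows "z \<in> ell2_spectrum (discrete_schroedinger V) \<longleftrightarrow>
    z \<in> \<real> \<and> (\<forall>\<epsilon>>0. \<exists>\<psi>. norm (schroedinger_l2 V z \<psi>) < \<epsilon> * norm \<psi>)"
proof (intro iffI conjI allI impI)
  assume z: "z \<in> ell2_spectrum (discrete_schroedinger V)"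
  show real: "z \<in> \<real>"
  proof (rule ccontr)
    assume "z \<notin> \<real>"
    then have "\<bar>Im z\<bar> > 0" by (simp add: complex_is_Real_iff)
    then have "z \<in> ell2_resolvent_set (discrete_schroedinger V)"
      using nonreal_energy_bounded_below[OF V, of z] nonreal_energy_bounded_below[OF V, of "cnj z"]
      by (intro resolvent_set_if_bounded_below[OF V]) auto
    then show False using z by (simp add: ell2_spectrum_def)
  qed
  fix \<epsilon> :: real assume "\<epsilon> > 0"
  then show "\<exists>\<psi>. norm (schroedinger_l2 V z \<psi>) < \<epsilon> * norm \<psi>"
    using resolvent_set_if_bounded_below[OF V, of \<epsilon> z] z real
    by (metis Compl_iff Reals_cnj_iff ell2_spectrum_def not_le)
next
  assume z: "z \<in> \<real> \<and> (\<forall>\<epsilon>>0. \<exists>\<psi>. norm (schroedinger_l2 V z \<psi>) < \<epsilon> * norm \<psi>)"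
  show "z \<in> ell2_spectrum (discrete_schroedinger V)"
  proof (rule ccontr)
    assume "z \<notin> ell2_spectrum (discrete_schroedinger V)"
    then have "z \<in> ell2_resolvent_set (discrete_schroedinger V)"
      by (simp add: ell2_spectrum_def)
    then obtain C where C: "C > 0" "\<And>\<psi>. norm \<psi> \<le> C * norm (schroedinger_l2 V z \<psi>)"
      using bounded_below_if_resolvent_set[OF V] by blast
    then obtain \<psi> where "norm (schroedinger_l2 V z \<psi>) < inverse C * norm \<psi>"
      using z by (metis positive_imp_inverse_positive)
    then show False using C(1) C(2)[of \<psi>] by (simp add: field_simps)
  qed
qed

section \<open>Finitely supported approximate eigenvectors\<close>

definition finitely_supported :: "l2 \<Rightarrow> bool"
  where "finitely_supported \<psi> \<longleftrightarrow> finite {n. coord \<psi> n \<noteq> 0}"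

lemma finitely_supported_dense:
  assumes "\<delta> > 0"
  obtains \<phi> where "finitely_supported \<phi>" "norm (\<psi> - \<phi>) \<le> \<delta>"
proof -
  let ?g = "\<lambda>n. (cmod (coord \<psi> n))\<^sup>2"
  obtain F where F: "finite F" "dist (sum ?g F) (infsum ?g UNIV) \<le> \<delta>\<^sup>2"
    using infsum_finite_approximation[OF coord_summable[of \<psi>], of "\<delta>\<^sup>2"] assms by auto
  define \<phi> where "\<phi> = mult_l2 (indicator F) \<psi>"
  have \<phi>: "coord \<phi> n = indicator F n * coord \<psi> n" for n
    unfolding \<phi>_def by (rule coord_mult_l2[where C = 1]) (simp add: indicator_def)
  have "finitely_supported \<phi>"
    unfolding finitely_supported_def using \<phi>
    by (intro finite_subset[OF _ F(1)]) (auto simp: indicator_def)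
  moreover have "(norm (\<psi> - \<phi>))\<^sup>2 = infsum ?g (UNIV - F)"
    unfolding l2_norm_sq by (intro infsum_cong_neutral) (auto simp: coord_simps \<phi>)
  then have "(norm (\<psi> - \<phi>))\<^sup>2 = infsum ?g UNIV - sum ?g F"
    using infsum_Diff[OF coord_summable[of \<psi>], of F] F(1) by simp
  then have "(norm (\<psi> - \<phi>))\<^sup>2 \<le> \<delta>\<^sup>2"
    using F(2) by (simp add: dist_real_def)
  then have "norm (\<psi> - \<phi>) \<le> \<delta>" using assms by (simp add: power2_le_iff_abs_le)
  ultimately show thesis by (rule that)
qed

lemma finitely_supported_approximate_eigenvector:
  assumes V: "bounded (range V)" and \<psi>: "norm (schroedinger_l2 V z \<psi>) < \<epsilon> * norm \<psi>"
    and \<epsilon>: "\<epsilon> > 0"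
  obtains \<phi> where "finitely_supported \<phi>" "norm (schroedinger_l2 V z \<phi>) < \<epsilon> * norm \<phi>"
proof -
  note bl = bounded_linear_schroedinger_l2[OF V, of z]
  obtain C where C: "C > 0" "\<And>\<phi>. norm (schroedinger_l2 V z \<phi>) \<le> norm \<phi> * C"
    using bounded_linear.pos_bounded[OF bl] by blast
  define gap where "gap = \<epsilon> * norm \<psi> - norm (schroedinger_l2 V z \<psi>)"
  \<comment> \<open>Replacing \<open>\<psi>\<close> by \<open>\<phi>\<close> moves the two sides of the strict inequality by at most \<open>\<delta> C\<close> and \<open>\<delta> \<epsilon>\<close>.\<close>
  define \<delta> where "\<delta> = gap / (2 * (C + \<epsilon>))"
  have gap: "gap > 0" using \<psi> by (simp add: gap_def)
  have \<delta>: "\<delta> > 0" "\<delta> * (C + \<epsilon>) = gap / 2" using gap C \<epsilon> by (simp_all add: \<delta>_def field_simps)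
  obtain \<phi> where \<phi>: "finitely_supported \<phi>" "norm (\<psi> - \<phi>) \<le> \<delta>"
    using finitely_supported_dense[OF \<delta>(1)] by blast
  have "norm (schroedinger_l2 V z \<psi> - schroedinger_l2 V z \<phi>) \<le> norm (\<psi> - \<phi>) * C"
    using C(2)[of "\<psi> - \<phi>"] by (simp add: linear_diff[OF bounded_linear.linear[OF bl]])
  also have "\<dots> \<le> \<delta> * C"
    using \<phi>(2) C(1) by (intro mult_right_mono) auto
  finally have "norm (schroedinger_l2 V z \<phi>) \<le> norm (schroedinger_l2 V z \<psi>) + \<delta> * C"
    using norm_triangle_ineq2[of "schroedinger_l2 V z \<phi>" "schroedinger_l2 V z \<psi>"]
    by (simp add: norm_minus_commute)
  also have "\<dots> < \<epsilon> * (norm \<psi> - \<delta>)"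
    using gap \<delta>(2) by (simp add: gap_def algebra_simps)
  also have "\<dots> \<le> \<epsilon> * norm \<phi>"
    using \<epsilon> \<phi>(2) norm_triangle_ineq2[of \<psi> \<phi>] by (intro mult_left_mono) auto
  finally show thesis using \<phi>(1) that by blast
qed

text \<open>The translate of \<open>\<psi>\<close> by \<open>s\<close> sees only the part of \<open>W\<close> over the translated support of \<open>\<psi>\<close>; over
  it \<open>W\<close> is a translate of \<open>V\<close> up to \<open>\<delta>\<close>.\<close>

lemma transplanted_approximate_eigenvector:
  assumes V: "bounded (range V)" and W: "bounded (range W)"
    and close: "\<And>n. coord \<psi> n \<noteq> 0 \<Longrightarrow> \<bar>W (s + n) - V n\<bar> \<le> \<delta>" and "0 \<le> \<delta>"
  shows "norm (schroedinger_l2 W z (shift_l2 (- s) \<psi>)) \<le> norm (schroedinger_l2 V z \<psi>) + \<delta> * norm \<psi>"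
proof -
  define w where "w n = complex_of_real (W (s + n) - V n)" for n
  have w: "cmod (w n) \<le> \<delta>" if "coord \<psi> n \<noteq> 0" for n
    using close[OF that] by (simp add: w_def del: of_real_diff)
  have coord: "coord (mult_l2 w \<psi>) n = w n * coord \<psi> n" for n
    using w by (rule coord_mult_l2)
  have "schroedinger_l2 W z (shift_l2 (- s) \<psi>) =
      shift_l2 (- s) (schroedinger_l2 V z \<psi> + mult_l2 w \<psi>)"
    by (rule l2_eqI)
      (simp add: coord_schroedinger_l2[OF V] coord_schroedinger_l2[OF W] shift_l2.rep_eq coord_simps
        coord discrete_schroedinger_def w_def algebra_simps)
  then have "norm (schroedinger_l2 W z (shift_l2 (- s) \<psi>)) = norm (schroedinger_l2 V z \<psi> + mult_l2 w \<psi>)"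
    by (simp add: norm_shift_l2)
  also have "\<dots> \<le> norm (schroedinger_l2 V z \<psi>) + \<delta> * norm \<psi>"
    using norm_mult_l2[of \<psi> w, OF w \<open>0 \<le> \<delta>\<close>]
    by (intro order.trans[OF norm_triangle_ineq] add_left_mono)
  finally show ?thesis .
qed

section \<open>Recurrence of minimal homeomorphisms\<close>

lemma iterate_int_Suc:
  assumes "bij T"
  shows "iterate_int T (m + 1) x = T (iterate_int T m x)"
proof (cases "0 \<le> m")
  case True
  then show ?thesis by (simp add: iterate_int_def nat_add_distrib)
next
  case False
  define k where "k = nat (- 1 - m)"
  have k: "m = - 1 - int k" using False by (simp add: k_def)
  have "T (inv T y) = y" for y
    using assms by (simp add: bij_is_surj surj_f_inv_f)
  moreover have "nat (- m) = Suc k" "nat (- (m + 1)) = k" using k by simp_all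
  ultimately show ?thesis
    using False by (cases "k = 0") (simp_all add: iterate_int_def k)
qed

lemma iterate_int_add:
  assumes "bij T"
  shows "iterate_int T (m + n) x = iterate_int T m (iterate_int T n x)"
proof (induction m rule: int_induct[where k = 0])
  case base
  show ?case by (simp add: iterate_int_def)
next
  case (step1 i)
  then show ?case
    using iterate_int_Suc[OF assms, of "i + n"] iterate_int_Suc[OF assms, of i] by (simp add: add_ac)
next
  case (step2 i)
  have "T (iterate_int T (i - 1 + n) x) = T (iterate_int T (i - 1) (iterate_int T n x))"
    using iterate_int_Suc[OF assms, of "i - 1 + n"] iterate_int_Suc[OF assms, of "i - 1"] step2
    by (simp add: add_ac)
  then show ?case
    using assms by (simp add: bij_is_inj inj_eq)
qed

lemma continuous_on_iterate_int:
  assumes "homeomorphism UNIV UNIV T (inv T)"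
  shows "continuous_on UNIV (iterate_int T n)"
proof -
  have "continuous_on UNIV (g ^^ k)" if "continuous_on UNIV g" for g :: "'a \<Rightarrow> 'a" and k
  proof (induction k)
    case (Suc k)
    then show ?case
      using continuous_on_compose[OF Suc continuous_on_subset[OF that]] by simp
  qed (simp add: id_def)
  then show ?thesis
    using assms by (simp add: iterate_int_def[abs_def] homeomorphism_def)
qed

lemma minimal_homeomorphism_bij: "minimal_homeomorphism T \<Longrightarrow> bij T"
  by (auto simp: minimal_homeomorphism_def homeomorphism_def intro!: bijI inj_on_inverseI[of _ "inv T"])

text \<open>Every orbit visits \<open>U\<close>, so the preimages of \<open>U\<close> under the iterates cover the space, and finitely
  many of them do. Hence from any time \<open>a\<close> the orbit is in \<open>U\<close> at some time within a fixed distance.\<close>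

lemma minimal_bounded_return_gaps:
  fixes T :: "'a::topological_space \<Rightarrow> 'a"
  assumes X: "compact (UNIV :: 'a set)" and T: "minimal_homeomorphism T"
    and U: "open U" "U \<noteq> {}"
  shows "\<exists>M::int. \<forall>a x. \<exists>n. \<bar>n - a\<bar> \<le> M \<and> iterate_int T n x \<in> U"
proof -
  have hom: "homeomorphism UNIV UNIV T (inv T)"
    and dense: "closure (range (\<lambda>n. iterate_int T n x)) = UNIV" for x
    using T unfolding minimal_homeomorphism_def by blast+
  define P where "P n = iterate_int T n -` U" for n
  have "open (P n)" for n
    unfolding P_def using continuous_on_iterate_int[OF hom] U(1)
    by (simp add: continuous_on_open_vimage)
  moreover have "UNIV \<subseteq> (\<Union>n\<in>UNIV. P n)"
  proof
    fix x
    have "U \<inter> range (\<lambda>n. iterate_int T n x) \<noteq> {}"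
      using open_Int_closure_eq_empty[OF U(1), of "range (\<lambda>n. iterate_int T n x)"] U(2)
      by (simp add: dense)
    then show "x \<in> (\<Union>n\<in>UNIV. P n)" by (auto simp: P_def)
  qed
  ultimately obtain J where "J \<subseteq> UNIV" and J: "finite J" "UNIV \<subseteq> (\<Union>n\<in>J. P n)"
    by (rule compactE_image[OF X])
  define M where "M = Max (abs ` J)"
  have M: "\<bar>n\<bar> \<le> M" if "n \<in> J" for n
    unfolding M_def using J(1) that by (intro Max_ge) auto
  have "\<exists>n. \<bar>n - a\<bar> \<le> M \<and> iterate_int T n x \<in> U" for a x
  proof -
    obtain j where "j \<in> J" "iterate_int T a x \<in> P j"
      using subsetD[OF J(2) UNIV_I] by (rule UN_E)
    then show ?thesis
      using M[of j] iterate_int_add[OF minimal_homeomorphism_bij[OF T], of j a x]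
      by (intro exI[of _ "j + a"]) (simp add: P_def)
  qed
  then show ?thesis by blast
qed

text \<open>One return time is taken near each multiple of a length \<open>L\<close> that exceeds twice the gap bound plus
  the diameter of \<open>F\<close>. This also works on a finite space, where orbits are periodic.\<close>

lemma minimal_separated_returns:
  fixes T :: "'a::topological_space \<Rightarrow> 'a"
  assumes X: "compact (UNIV :: 'a set)" and T: "minimal_homeomorphism T"
    and U: "open U" "U \<noteq> {}" and F: "finite F"
  obtains s :: "nat \<Rightarrow> int"
  where "\<And>i. iterate_int T (s i) x \<in> U" "disjoint_family (\<lambda>i. (+) (s i) ` F)"
proof -
  obtain M :: int where M: "\<And>a x. \<exists>n. \<bar>n - a\<bar> \<le> M \<and> iterate_int T n x \<in> U"
    using minimal_bounded_return_gaps[OF X T U] by blast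
  define K where "K = Max (abs ` F)"
  have K: "\<bar>n\<bar> \<le> K" if "n \<in> F" for n
    unfolding K_def using F that by (intro Max_ge) auto
  \<comment> \<open>The absolute value of \<open>K\<close> guards against empty \<open>F\<close>, for which the maximum \<open>K\<close> is arbitrary.\<close>
  define L where "L = 2 * M + 2 * \<bar>K\<bar> + 1"
  define s where "s i = (SOME n. \<bar>n - int i * L\<bar> \<le> M \<and> iterate_int T n x \<in> U)" for i :: nat
  have s: "\<bar>s i - int i * L\<bar> \<le> M" "iterate_int T (s i) x \<in> U" for i
    unfolding s_def by (rule someI2_ex[OF M], simp)+
  have M0: "M \<ge> 0" using s(1)[of 0] by simp
  have "s i + m \<noteq> s j + n" if "i < j" "m \<in> F" "n \<in> F" for i j m n
  proof -
    have "int i * L + L \<le> int j * L"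
      using mult_right_mono[of "int i + 1" "int j" L] that(1) M0 by (simp add: L_def algebra_simps)
    then show ?thesis
      using s(1)[of i] s(1)[of j] K[OF that(2)] K[OF that(3)] unfolding L_def by linarith
  qed
  then have "disjoint_family (\<lambda>i. (+) (s i) ` F)"
    unfolding disjoint_family_on_def by (fastforce simp: neq_iff)
  with s(2) show thesis by (rule that)
qed

section \<open>Patterns in independent random configurations\<close>

text \<open>A point outside the support has a null neighbourhood, which contains a null set of a countable base
  around that point.\<close>

lemma AE_topological_support:
  fixes M :: "'a::second_countable_topology measure"
  assumes "sets M = sets borel"
  shows "AE x in M. x \<in> topological_support M"
proof -
  obtain \<B> :: "'a set set" where \<B>: "countable \<B>" "topological_basis \<B>"
    using ex_countable_basis by blast
  have "AE x in M. \<forall>B\<in>{B\<in>\<B>. emeasure M B = 0}. x \<notin> B"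
  proof (rule AE_ball_countable')
    fix B assume "B \<in> {B\<in>\<B>. emeasure M B = 0}"
    then have "B \<in> null_sets M"
      using topological_basis_open[OF \<B>(2)] assms by (intro null_setsI) auto
    then show "AE x in M. x \<notin> B" by (rule AE_not_in)
  qed (use \<B>(1) in auto)
  moreover have "x \<in> topological_support M" if "\<forall>B\<in>{B\<in>\<B>. emeasure M B = 0}. x \<notin> B" for x
    unfolding topological_support_def
  proof safe
    fix U :: "'a set" assume U: "open U" "x \<in> U"
    then obtain B where B: "B \<in> \<B>" "x \<in> B" "B \<subseteq> U"
      using topological_basisE[OF \<B>(2)] by blast
    have "emeasure M B > 0" using that B(1,2) zero_less_iff_neq_zero by blast
    also have "emeasure M B \<le> emeasure M U"
      using U B assms by (intro emeasure_mono) auto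
    finally show "emeasure M U > 0" .
  qed
  ultimately show ?thesis by (auto elim: eventually_mono)
qed

lemma AE_PiM_topological_support:
  fixes \<nu> :: "real measure"
  assumes "prob_space \<nu>" "sets \<nu> = sets borel"
  shows "AE \<omega> in Pi\<^sub>M (UNIV :: 'i::countable set) (\<lambda>_. \<nu>). range \<omega> \<subseteq> topological_support \<nu>"
proof -
  interpret product_prob_space "\<lambda>_::'i. \<nu>" UNIV
    using assms(1) by (simp add: product_prob_space_def product_prob_space_axioms_def
        product_sigma_finite_def prob_space_imp_sigma_finite)
  have "AE \<omega> in Pi\<^sub>M (UNIV :: 'i set) (\<lambda>_. \<nu>). \<forall>i. \<omega> i \<in> topological_support \<nu>"
    unfolding AE_all_countable
    using AE_component[OF UNIV_I AE_topological_support[OF assms(2)]] by simp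
  then show ?thesis by (auto elim: eventually_mono)
qed

text \<open>The event that \<open>\<omega>\<close> imitates \<open>\<eta>\<close> on the \<open>i\<close>-th translate has the same probability \<open>p > 0\<close> for every
  \<open>i\<close>, because \<open>\<eta>\<close> takes its values in the support. Disjoint blocks of coordinates are independent,
  so all of the first \<open>k\<close> attempts fail with probability \<open>(1 - p)\<^sup>k\<close>.\<close>

lemma AE_pattern_occurs:
  fixes \<nu> :: "real measure" and s :: "nat \<Rightarrow> int"
  assumes \<nu>: "prob_space \<nu>" "sets \<nu> = sets borel" and F: "finite F"
    and s: "disjoint_family (\<lambda>i. (+) (s i) ` F)"
    and \<eta>: "range \<eta> \<subseteq> topological_support \<nu>" and "\<delta> > 0"
  shows "AE \<omega> in Pi\<^sub>M UNIV (\<lambda>_. \<nu>). \<exists>i. \<forall>n\<in>F. \<bar>\<omega> (s i + n) - \<eta> n\<bar> < \<delta>"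
proof -
  interpret product_prob_space "\<lambda>_::int. \<nu>" UNIV
    using \<nu>(1) by (simp add: product_prob_space_def product_prob_space_axioms_def
        product_sigma_finite_def prob_space_imp_sigma_finite)
  have [simp]: "space \<nu> = UNIV"
    using sets_eq_imp_space_eq[OF \<nu>(2)] by simp
  let ?M = "Pi\<^sub>M UNIV (\<lambda>_::int. \<nu>)"
  define K where "K i = (+) (s i) ` F" for i
  define B where "B i = Pi\<^sub>E (K i) (\<lambda>m. ball (\<eta> (m - s i)) \<delta>)" for i
  define Bad where "Bad i = space (Pi\<^sub>M (K i) (\<lambda>_. \<nu>)) - B i" for i
  define X where "X i = (\<lambda>\<omega>::int \<Rightarrow> real. restrict \<omega> (K i))" for i
  have finK: "finite (K i)" for i using F by (simp add: K_def)
  have B_sets: "B i \<in> sets (Pi\<^sub>M (K i) (\<lambda>_. \<nu>))" for i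
    unfolding B_def using finK \<nu>(2) by (intro sets_PiM_I_finite) auto
  have Bad_sets: "Bad i \<in> sets (Pi\<^sub>M (K i) (\<lambda>_. \<nu>))" for i
    unfolding Bad_def using B_sets by auto
  have "P.indep_vars (\<lambda>_. \<nu>) (\<lambda>m \<omega>. \<omega> m) UNIV"
    by (subst P.indep_vars_iff_distr_eq_PiM') (simp_all add: PiM_component restrict_def)
  then have indep: "P.indep_vars (\<lambda>i. Pi\<^sub>M (K i) (\<lambda>_. \<nu>)) X UNIV"
    unfolding X_def using s by (intro P.indep_vars_restrict) (auto simp: K_def)
  have X_meas: "X i \<in> measurable ?M (Pi\<^sub>M (K i) (\<lambda>_. \<nu>))" for i
    unfolding X_def by (rule measurable_restrict_subset) simp
  define p where "p = (\<Prod>n\<in>F. measure \<nu> (ball (\<eta> n) \<delta>))"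
  have "measure \<nu> (ball (\<eta> n) \<delta>) > 0" for n
  proof -
    have "\<eta> n \<in> topological_support \<nu>" using \<eta> by blast
    then have "emeasure \<nu> (ball (\<eta> n) \<delta>) > 0"
      using \<open>\<delta> > 0\<close> by (simp add: topological_support_def)
    then show ?thesis by (simp add: M.emeasure_eq_measure)
  qed
  then have "p > 0" unfolding p_def by (intro prod_pos) auto
  have prob_B: "P.prob (X i -` B i \<inter> space ?M) = p" for i
  proof -
    have "X i -` B i \<inter> space ?M = emb UNIV (K i) (B i)"
      by (simp add: X_def prod_emb_def space_PiM)
    then have "P.prob (X i -` B i \<inter> space ?M) = (\<Prod>m\<in>K i. measure \<nu> (ball (\<eta> (m - s i)) \<delta>))"
      unfolding B_def using finK \<nu>(2) by (simp add: measure_PiM_emb)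
    also have "\<dots> = p"
      unfolding K_def p_def by (subst prod.reindex) (auto simp: inj_on_def)
    finally show ?thesis .
  qed
  have prob_Bad: "P.prob (X i -` Bad i \<inter> space ?M) = 1 - p" for i
  proof -
    have "X i -` Bad i \<inter> space ?M = space ?M - (X i -` B i \<inter> space ?M)"
      using measurable_space[OF X_meas[of i]] by (auto simp: Bad_def)
    then show ?thesis
      using P.prob_compl[OF measurable_sets[OF X_meas B_sets]] prob_B by simp
  qed
  define N where "N = (\<Inter>i. X i -` Bad i \<inter> space ?M)"
  have N_sets: "N \<in> sets ?M"
    unfolding N_def using measurable_sets[OF X_meas Bad_sets] by (intro sets.countable_INT) auto
  \<comment> \<open>The product rule for independent variables requires a nonempty index set.\<close>
  have "P.prob N \<le> (1 - p) ^ k" if "k > 0" for k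
  proof -
    have "P.prob N \<le> P.prob (\<Inter>i<k. X i -` Bad i \<inter> space ?M)"
      using measurable_sets[OF X_meas Bad_sets] that
      by (intro P.finite_measure_mono sets.finite_INT) (auto simp: N_def)
    also have "\<dots> = (\<Prod>i<k. P.prob (X i -` Bad i \<inter> space ?M))"
      using that Bad_sets by (intro P.indep_varsD[OF indep]) auto
    finally show ?thesis by (simp add: prob_Bad)
  qed
  moreover have "0 \<le> 1 - p" "1 - p < 1"
    using prob_Bad[of 0] \<open>p > 0\<close> measure_nonneg[of ?M "X 0 -` Bad 0 \<inter> space ?M"] by simp_all
  then have "(\<lambda>k. (1 - p) ^ k) \<longlonglongrightarrow> 0"
    by (intro LIMSEQ_realpow_zero)
  ultimately have "P.prob N \<le> 0"
    using LIMSEQ_le_const[of "\<lambda>k. (1 - p) ^ k" 0 "P.prob N"] by (metis less_le_trans zero_less_one)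
  then have "P.prob N = 0"
    using measure_nonneg[of ?M N] by linarith
  then have "N \<in> null_sets ?M"
    using N_sets by (auto simp: P.emeasure_eq_measure)
  then have "AE \<omega> in ?M. \<omega> \<notin> N" by (rule AE_not_in)
  then show ?thesis
  proof eventually_elim
    case (elim \<omega>)
    then obtain i where "X i \<omega> \<notin> Bad i"
      by (auto simp: N_def space_PiM)
    then have "X i \<omega> \<in> B i"
      by (auto simp: Bad_def X_def space_PiM)
    then have "\<forall>n\<in>F. \<omega> (s i + n) \<in> ball (\<eta> n) \<delta>"
      by (auto simp: B_def X_def K_def PiE_iff)
    then show ?case
      by (auto simp: dist_real_def abs_minus_commute)
  qed
qed

section \<open>The almost sure spectrum\<close>

definition orbit_potential :: "('a \<Rightarrow> 'a) \<Rightarrow> ('a \<Rightarrow> real) \<Rightarrow> 'a \<Rightarrow> (int \<Rightarrow> real) \<Rightarrow> int \<Rightarrow> real"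
  where "orbit_potential T f x \<omega> n = f (iterate_int T n x) + \<omega> n"

lemma random_schroedinger_eq:
  "random_schroedinger T f x \<omega> = discrete_schroedinger (orbit_potential T f x \<omega>)"
  by (intro ext) (simp add: random_schroedinger_def discrete_schroedinger_def orbit_potential_def)

text \<open>Every point of the space is admitted as base point; minimality will make the choice immaterial.
  Since the inequality is strict, \<open>\<psi>\<close> is not zero.\<close>

definition approximate_energies :: "('a \<Rightarrow> 'a) \<Rightarrow> ('a \<Rightarrow> real) \<Rightarrow> real set \<Rightarrow> real set"
  where "approximate_energies T f K = {E. \<forall>\<epsilon>>0. \<exists>x \<eta> \<psi>. range \<eta> \<subseteq> K \<and> finitely_supported \<psi> \<and>
    norm (schroedinger_l2 (orbit_potential T f x \<eta>) (of_real E) \<psi>) < \<epsilon> * norm \<psi>}"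

lemma approximate_energies_mono: "K \<subseteq> L \<Longrightarrow> approximate_energies T f K \<subseteq> approximate_energies T f L"
proof
  fix E assume "K \<subseteq> L" and E: "E \<in> approximate_energies T f K"
  then show "E \<in> approximate_energies T f L"
    unfolding approximate_energies_def using subset_trans[of _ K L] by (simp, meson)
qed

lemma orbit_potential_uniformly_bounded:
  fixes f :: "'a::topological_space \<Rightarrow> real"
  assumes "compact (UNIV :: 'a set)" "continuous_on UNIV f" "bounded K"
  shows "\<exists>C. \<forall>x \<eta> n. range \<eta> \<subseteq> K \<longrightarrow> \<bar>orbit_potential T f x \<eta> n\<bar> \<le> C"
proof -
  have "bounded (range f)"
    using compact_continuous_image[OF assms(2,1)] by (rule compact_imp_bounded)
  then obtain a where a: "\<And>y. \<bar>f y\<bar> \<le> a" by (auto simp: bounded_iff)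
  obtain b where b: "\<And>y. y \<in> K \<Longrightarrow> \<bar>y\<bar> \<le> b" using assms(3) by (auto simp: bounded_iff)
  show ?thesis
  proof (intro exI[of _ "a + b"] allI impI)
    fix x and \<eta> :: "int \<Rightarrow> real" and n assume "range \<eta> \<subseteq> K"
    then have "\<bar>\<eta> n\<bar> \<le> b" by (intro b) auto
    then show "\<bar>orbit_potential T f x \<eta> n\<bar> \<le> a + b"
      using a[of "iterate_int T n x"] unfolding orbit_potential_def by linarith
  qed
qed

lemma bounded_range_orbit_potential:
  fixes f :: "'a::topological_space \<Rightarrow> real"
  assumes "compact (UNIV :: 'a set)" "continuous_on UNIV f" "bounded K" "range \<eta> \<subseteq> K"
  shows "bounded (range (orbit_potential T f x \<eta>))"
proof -
  obtain C where "\<And>x \<eta> n. range \<eta> \<subseteq> K \<Longrightarrow> \<bar>orbit_potential T f x \<eta> n\<bar> \<le> C"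
    using orbit_potential_uniformly_bounded[OF assms(1-3), of T] by blast
  then show ?thesis using assms(4) by (auto simp: bounded_iff)
qed

lemma norm_schroedinger_l2_energy_change:
  assumes "bounded (range V)"
  shows "norm (schroedinger_l2 V z' \<psi>) \<le> norm (schroedinger_l2 V z \<psi>) + cmod (z - z') * norm \<psi>"
  unfolding schroedinger_l2_energy_change[OF assms, of z' \<psi> z]
  by (intro order.trans[OF norm_triangle_ineq] add_left_mono norm_mult_l2) auto

text \<open>A uniform bound on the operators bounds the energies. The set is closed because a vector that serves
  one energy with error \<open>\<epsilon> / 2\<close> serves every energy at distance less than \<open>\<epsilon> / 2\<close> with error \<open>\<epsilon>\<close>.\<close>

lemma compact_approximate_energies:
  fixes f :: "'a::topological_space \<Rightarrow> real"
  assumes X: "compact (UNIV :: 'a set)" and f: "continuous_on UNIV f" and K: "bounded K"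
  shows "compact (approximate_energies T f K)"
  unfolding compact_eq_bounded_closed
proof
  note bdd = bounded_range_orbit_potential[OF X f K]
  obtain C where C: "\<And>x \<eta> n. range \<eta> \<subseteq> K \<Longrightarrow> \<bar>orbit_potential T f x \<eta> n\<bar> \<le> C"
    using orbit_potential_uniformly_bounded[OF X f K, of T] by blast
  have "\<bar>E\<bar> \<le> 3 + C" if E: "E \<in> approximate_energies T f K" for E
  proof -
    obtain x \<eta> \<psi> where \<eta>: "range \<eta> \<subseteq> K"
      and \<psi>: "norm (schroedinger_l2 (orbit_potential T f x \<eta>) (of_real E) \<psi>) < norm \<psi>"
      using E[unfolded approximate_energies_def, THEN CollectD, rule_format, OF zero_less_one] by auto
    let ?A = "schroedinger_l2 (orbit_potential T f x \<eta>)"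
    have "mult_l2 (\<lambda>_. of_real E) \<psi> = ?A 0 \<psi> - ?A (of_real E) \<psi>"
      using schroedinger_l2_energy_change[OF bdd[OF \<eta>, of T x], of 0 \<psi> "of_real E"] by simp
    moreover have "mult_l2 (\<lambda>_. of_real E) \<psi> = E *\<^sub>R \<psi>"
      by (rule l2_eqI) (simp add: coord_mult_l2_bounded coord_simps scaleR_conv_of_real)
    ultimately have "\<bar>E\<bar> * norm \<psi> \<le> norm (?A 0 \<psi>) + norm (?A (of_real E) \<psi>)"
      by (metis norm_scaleR norm_triangle_ineq4)
    also have "\<dots> \<le> (2 + C) * norm \<psi> + norm \<psi>"
      using norm_schroedinger_l2_le[of "orbit_potential T f x \<eta>" C 0 \<psi>] C[OF \<eta>, of x] \<psi> by simp
    also have "\<dots> = (3 + C) * norm \<psi>" by (simp add: algebra_simps)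
    finally show ?thesis
      using le_less_trans[OF norm_ge_zero \<psi>] by (rule mult_right_le_imp_le)
  qed
  then show "bounded (approximate_energies T f K)"
    unfolding bounded_iff by (intro exI[of _ "3 + C"]) simp
  show "closed (approximate_energies T f K)"
    unfolding closed_limpt
  proof (intro allI impI)
    fix E assume "E islimpt approximate_energies T f K"
    show "E \<in> approximate_energies T f K"
      unfolding approximate_energies_def
    proof (intro CollectI allI impI)
      fix \<epsilon> :: real assume \<epsilon>: "\<epsilon> > 0"
      then obtain E' where E': "E' \<in> approximate_energies T f K" "dist E' E < \<epsilon> / 2"
        using \<open>E islimpt _\<close>[unfolded islimpt_approachable, rule_format, OF half_gt_zero[OF \<epsilon>]] by blast
      obtain x \<eta> \<psi> where \<eta>: "range \<eta> \<subseteq> K" and fin: "finitely_supported \<psi>"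
        and \<psi>: "norm (schroedinger_l2 (orbit_potential T f x \<eta>) (of_real E') \<psi>) < \<epsilon> / 2 * norm \<psi>"
        using E'(1)[unfolded approximate_energies_def, THEN CollectD, rule_format, OF half_gt_zero[OF \<epsilon>]]
        by blast
      have "cmod (of_real E' - of_real E) * norm \<psi> \<le> \<epsilon> / 2 * norm \<psi>"
        using E'(2) by (intro mult_right_mono) (simp_all add: dist_real_def flip: of_real_diff)
      then have "norm (schroedinger_l2 (orbit_potential T f x \<eta>) (of_real E) \<psi>) < \<epsilon> * norm \<psi>"
        using norm_schroedinger_l2_energy_change[OF bdd[OF \<eta>, of T x], of "of_real E" \<psi> "of_real E'"] \<psi>
        by (simp add: field_simps)
      then show "\<exists>x \<eta> \<psi>. range \<eta> \<subseteq> K \<and> finitely_supported \<psi> \<and>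
          norm (schroedinger_l2 (orbit_potential T f x \<eta>) (of_real E) \<psi>) < \<epsilon> * norm \<psi>"
        using \<eta> fin by blast
    qed
  qed
qed

text \<open>The error \<open>\<epsilon>\<close> is divided into \<open>\<epsilon> / 2\<close> for the given approximate eigenvector and \<open>\<epsilon> / 4\<close> each for
  the deviations of \<open>f\<close> along the orbit and of the random values over its support.\<close>

lemma AE_approximate_eigenvector:
  fixes T :: "'a::metric_space \<Rightarrow> 'a"
  assumes X: "compact (UNIV :: 'a set)" and T: "minimal_homeomorphism T"
    and f: "continuous_on UNIV f" and \<nu>: "compactly_supported_prob \<nu>"
    and E: "E \<in> approximate_energies T f (topological_support \<nu>)" and \<epsilon>: "\<epsilon> > 0"
  shows "AE \<omega> in Pi\<^sub>M UNIV (\<lambda>_. \<nu>).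
    \<exists>\<psi>. norm (schroedinger_l2 (orbit_potential T f x \<omega>) (of_real E) \<psi>) < \<epsilon> * norm \<psi>"
proof -
  let ?K = "topological_support \<nu>"
  have prob: "prob_space \<nu>" "sets \<nu> = sets borel" and K: "bounded ?K"
    using \<nu> by (auto simp: compactly_supported_prob_def compact_imp_bounded)
  have hom: "homeomorphism UNIV UNIV T (inv T)"
    using T by (simp add: minimal_homeomorphism_def)
  note bdd = bounded_range_orbit_potential[OF X f K]
  obtain y \<eta> \<psi> where \<eta>: "range \<eta> \<subseteq> ?K" and fin: "finitely_supported \<psi>"
    and \<psi>: "norm (schroedinger_l2 (orbit_potential T f y \<eta>) (of_real E) \<psi>) < \<epsilon> / 2 * norm \<psi>"
    using E[unfolded approximate_energies_def, THEN CollectD, rule_format, OF half_gt_zero[OF \<epsilon>]]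
    by blast
  define F where "F = {n. coord \<psi> n \<noteq> 0}"
  have F: "finite F" using fin by (simp add: F_def finitely_supported_def)
  define g where "g n u = f (iterate_int T n u)" for n u
  have g: "continuous_on UNIV (g n)" for n
    unfolding g_def using continuous_on_compose2[OF f continuous_on_iterate_int[OF hom]] by simp
  \<comment> \<open>When the orbit of \<open>x\<close> enters \<open>U\<close> at time \<open>s\<close>, the values of \<open>f\<close> at the times \<open>s + n\<close> imitate those
    along the orbit of \<open>y\<close>.\<close>
  define U where "U = (\<Inter>n\<in>F. g n -` ball (g n y) (\<epsilon> / 4))"
  have "open U"
    unfolding U_def using F by (intro open_INT ballI open_vimage[OF open_ball g])
  moreover have "y \<in> U" using \<epsilon> by (simp add: U_def)
  ultimately obtain s where s: "\<And>i. iterate_int T (s i) x \<in> U"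
    and disj: "disjoint_family (\<lambda>i::nat. (+) (s i) ` F)"
    using minimal_separated_returns[OF X T _ _ F, of U x] by blast
  have "\<epsilon> / 4 > 0" using \<epsilon> by simp
  from AE_pattern_occurs[OF prob F disj \<eta> this] AE_PiM_topological_support[OF prob]
  show ?thesis
  proof eventually_elim
    case (elim \<omega>)
    then obtain i where i: "\<And>n. n \<in> F \<Longrightarrow> \<bar>\<omega> (s i + n) - \<eta> n\<bar> < \<epsilon> / 4" by blast
    have "\<bar>orbit_potential T f x \<omega> (s i + n) - orbit_potential T f y \<eta> n\<bar> \<le> \<epsilon> / 2"
      if "coord \<psi> n \<noteq> 0" for n
    proof -
      have n: "n \<in> F" using that by (simp add: F_def)
      have "iterate_int T n (iterate_int T (s i) x) = iterate_int T (s i + n) x"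
        using iterate_int_add[OF minimal_homeomorphism_bij[OF T], of n "s i" x] by (simp add: add.commute)
      then have "\<bar>f (iterate_int T (s i + n) x) - f (iterate_int T n y)\<bar> < \<epsilon> / 4"
        using s[of i] n by (auto simp: U_def g_def dist_real_def abs_minus_commute)
      then show ?thesis using i[OF n] unfolding orbit_potential_def by linarith
    qed
    then have "norm (schroedinger_l2 (orbit_potential T f x \<omega>) (of_real E) (shift_l2 (- s i) \<psi>))
        \<le> norm (schroedinger_l2 (orbit_potential T f y \<eta>) (of_real E) \<psi>) + \<epsilon> / 2 * norm \<psi>"
      using \<epsilon> by (intro transplanted_approximate_eigenvector bdd[OF \<eta>] bdd[OF elim(2)]) auto
    also have "\<dots> < \<epsilon> * norm (shift_l2 (- s i) \<psi>)"
      using \<psi> by (simp add: norm_shift_l2 field_simps)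
    finally show ?case by blast
  qed
qed

text \<open>A countable dense set \<open>D\<close> of energies leaves one null set for each base point; outside of it, the
  density of \<open>D\<close> extends the approximate eigenvectors to all energies.\<close>

lemma is_almost_sure_spectrum_approximate_energies:
  fixes T :: "'a::metric_space \<Rightarrow> 'a"
  assumes X: "compact (UNIV :: 'a set)" and T: "minimal_homeomorphism T"
    and f: "continuous_on UNIV f" and \<nu>: "compactly_supported_prob \<nu>"
  shows "is_almost_sure_spectrum T f \<nu> (approximate_energies T f (topological_support \<nu>))"
  unfolding is_almost_sure_spectrum_def
proof (intro conjI allI)
  let ?K = "topological_support \<nu>"
  let ?S = "approximate_energies T f ?K"
  have prob: "prob_space \<nu>" "sets \<nu> = sets borel" and K: "bounded ?K"
    using \<nu> by (auto simp: compactly_supported_prob_def compact_imp_bounded)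
  note bdd = bounded_range_orbit_potential[OF X f K]
  show "compact ?S" using compact_approximate_energies[OF X f K] .
  fix x
  obtain D where D: "countable D" "D \<subseteq> ?S" "?S \<subseteq> closure D"
    by (rule separable)
  have "AE \<omega> in Pi\<^sub>M UNIV (\<lambda>_. \<nu>). \<forall>E\<in>D. \<forall>k::nat.
      \<exists>\<psi>. norm (schroedinger_l2 (orbit_potential T f x \<omega>) (of_real E) \<psi>) < inverse (Suc k) * norm \<psi>"
    using AE_approximate_eigenvector[OF X T f \<nu>] D
    by (intro AE_ball_countable' iffD2[OF AE_all_countable] allI) auto
  with AE_PiM_topological_support[OF prob]
  show "AE \<omega> in Pi\<^sub>M UNIV (\<lambda>_. \<nu>).
      ell2_spectrum (random_schroedinger T f x \<omega>) = complex_of_real ` ?S"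
  proof eventually_elim
    case (elim \<omega>)
    let ?A = "schroedinger_l2 (orbit_potential T f x \<omega>)"
    note V = bdd[OF elim(1), of T x]
    \<comment> \<open>Half of \<open>\<epsilon>\<close> pays for the passage from \<open>E\<close> to a nearby energy in \<open>D\<close>.\<close>
    have approx: "\<exists>\<psi>. norm (?A (of_real E) \<psi>) < \<epsilon> * norm \<psi>" if E: "E \<in> ?S" and \<epsilon>: "\<epsilon> > 0" for E \<epsilon>
    proof -
      obtain E' where E': "E' \<in> D" "dist E' E < \<epsilon> / 2"
        using E D(3) half_gt_zero[OF \<epsilon>] unfolding closure_approachable subset_iff by blast
      obtain k where k: "inverse (Suc k) < \<epsilon> / 2"
        using reals_Archimedean[OF half_gt_zero[OF \<epsilon>]] by blast
      obtain \<psi> where \<psi>: "norm (?A (of_real E') \<psi>) < inverse (Suc k) * norm \<psi>"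
        using elim(2) E'(1) by blast
      have "inverse (Suc k) * norm \<psi> \<le> \<epsilon> / 2 * norm \<psi>"
        using k by (intro mult_right_mono) auto
      moreover have "cmod (of_real E' - of_real E) * norm \<psi> \<le> \<epsilon> / 2 * norm \<psi>"
        using E'(2) by (intro mult_right_mono) (simp_all add: dist_real_def flip: of_real_diff)
      moreover note \<psi> norm_schroedinger_l2_energy_change[OF V, of "of_real E" \<psi> "of_real E'"]
      ultimately have "norm (?A (of_real E) \<psi>) < \<epsilon> / 2 * norm \<psi> + \<epsilon> / 2 * norm \<psi>" by linarith
      then show ?thesis by (intro exI[of _ \<psi>]) (simp add: field_simps)
    qed
    have spectrum_le: "E \<in> ?S" if E: "of_real E \<in> ell2_spectrum (discrete_schroedinger (orbit_potential T f x \<omega>))" for E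
      unfolding approximate_energies_def
    proof (intro CollectI allI impI)
      fix \<epsilon> :: real assume \<epsilon>: "\<epsilon> > 0"
      then obtain \<psi> where "norm (?A (of_real E) \<psi>) < \<epsilon> * norm \<psi>"
        using E unfolding spectrum_iff_approximate_eigenvectors[OF V] by blast
      then obtain \<phi> where "finitely_supported \<phi>" "norm (?A (of_real E) \<phi>) < \<epsilon> * norm \<phi>"
        using finitely_supported_approximate_eigenvector[OF V _ \<epsilon>] by blast
      then show "\<exists>x \<eta> \<psi>. range \<eta> \<subseteq> ?K \<and> finitely_supported \<psi> \<and>
          norm (schroedinger_l2 (orbit_potential T f x \<eta>) (of_real E) \<psi>) < \<epsilon> * norm \<psi>"
        using elim(1) by blast
    qed
    have "z \<in> complex_of_real ` ?S"
      if z: "z \<in> ell2_spectrum (discrete_schroedinger (orbit_potential T f x \<omega>))" for z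
    proof -
      obtain E where "z = of_real E"
        using z unfolding spectrum_iff_approximate_eigenvectors[OF V] Reals_def by blast
      then show ?thesis using z spectrum_le by blast
    qed
    moreover have "of_real E \<in> ell2_spectrum (discrete_schroedinger (orbit_potential T f x \<omega>))"
      if "E \<in> ?S" for E
      unfolding spectrum_iff_approximate_eigenvectors[OF V] using approx[OF that] by simp
    ultimately show ?case
      unfolding random_schroedinger_eq by blast
  qed
qed

lemma almost_sure_spectrum_unique:
  assumes "prob_space \<nu>" "is_almost_sure_spectrum T f \<nu> S" "is_almost_sure_spectrum T f \<nu> S'"
  shows "S = S'"
proof -
  interpret P: prob_space "Pi\<^sub>M (UNIV :: int set) (\<lambda>_. \<nu>)"
    using assms(1) by (intro prob_space_PiM)
  have "AE \<omega> in Pi\<^sub>M UNIV (\<lambda>_. \<nu>).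
      ell2_spectrum (random_schroedinger T f undefined \<omega>) = complex_of_real ` S \<and>
      ell2_spectrum (random_schroedinger T f undefined \<omega>) = complex_of_real ` S'"
    using assms(2,3) unfolding is_almost_sure_spectrum_def by (intro AE_conjI) blast+
  then have "AE \<omega> in Pi\<^sub>M (UNIV :: int set) (\<lambda>_. \<nu>). complex_of_real ` S = complex_of_real ` S'"
    by (rule eventually_mono) (erule conjE, erule (1) trans[OF sym])
  then have "complex_of_real ` S = complex_of_real ` S'"
    by (simp add: P.AE_const)
  then show ?thesis by (simp add: inj_image_eq_iff inj_of_real)
qed

lemma almost_sure_spectrum_eq:
  fixes T :: "'a::metric_space \<Rightarrow> 'a"
  assumes "compact (UNIV :: 'a set)" "minimal_homeomorphism T"
    and "continuous_on UNIV f" "compactly_supported_prob \<nu>"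
  shows "almost_sure_spectrum T f \<nu> = approximate_energies T f (topological_support \<nu>)"
  unfolding almost_sure_spectrum_def
proof (rule the_equality)
  show *: "is_almost_sure_spectrum T f \<nu> (approximate_energies T f (topological_support \<nu>))"
    using assms by (rule is_almost_sure_spectrum_approximate_energies)
  fix S assume "is_almost_sure_spectrum T f \<nu> S"
  then show "S = approximate_energies T f (topological_support \<nu>)"
    using assms(4) * by (intro almost_sure_spectrum_unique) (auto simp: compactly_supported_prob_def)
qed

theorem theorem1p2:
  fixes T :: "'a::metric_space \<Rightarrow> 'a"
    and f :: "'a \<Rightarrow> real"
    and \<nu>\<^sub>1 \<nu>\<^sub>2 :: "real measure"
  assumes "compact (UNIV :: 'a set)"
    and "minimal_homeomorphism T"
    and "continuous_on UNIV f"
    and "compactly_supported_prob \<nu>\<^sub>1"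
    and "compactly_supported_prob \<nu>\<^sub>2"
    and "topological_support \<nu>\<^sub>1 \<subseteq> topological_support \<nu>\<^sub>2"
  shows "almost_sure_spectrum T f \<nu>\<^sub>1 \<subseteq> almost_sure_spectrum T f \<nu>\<^sub>2"
  using approximate_energies_mono[OF assms(6)] assms(1-5) by (simp add: almost_sure_spectrum_eq)

end
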